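(* Write $H_n(x)=\mathrm{Hilb}\,\mathcal A_{\mathcal P_n}(x)$. For $n\ge3$: if $n$ is even, $$H_{n+1}(x)=xH_n'(x)+H_n(x);$$ if $n$ is odd, $$H_{n+3}(x)=xH_{n+2}'(x)+H_{n+2}(x)+\frac{4n}{n+3}xH_{n+1}'(x)-\frac{8n}{n+3}xH_n'(x)-\frac{4n}{n+3}x^2H_n''(x),$$ where primes denote differentiation with respect to $x$. Moreover $H_3(x)=\frac{1}{(1-x)^2}$ and $H_4(x)=\frac{1+x}{(1-x)^2}$.
   Context: $[n]=\{1,\dots,n\}$; $\mathfrak S_n$ is the set of permutations of $[n]$ in one-line notation. The circular peak set of $\sigma\in\mathfrak S_n$ is $CP(\sigma)=\{\sigma(i)\mid 2\le i\le n-1,\ \sigma(i-1)<\sigma(i)>\sigma(i+1)\}$; for $S\subseteq[n]$, $CP_n(S)=\{\sigma\in\mathfrak S_n\mid CP(\sigma)=S\}$, and $\mathcal P_n=\{S\subseteq[n]\mid CP_n(S)\neq\emptyset\}$, ordered by inclusion. Fix a field $\mathbb K$, let $m=|\mathcal P_n|$ and enumerate $\mathcal P_n=\{S_{n,1},\dots,S_{n,m}\}$. $\mathcal I_{\mathcal P_n}\subseteq\mathbb K[x_1,\dots,x_m]$ is the ideal generated by all $x_ix_j$ such that $S_{n,i}$ and $S_{n,j}$ are incomparable under inclusion, and $\mathcal A_{\mathcal P_n}=\mathbb K[x_1,\dots,x_m]/\mathcal I_{\mathcal P_n}$, graded by degree. For a graded algebra $\mathcal A=\bigoplus_{k\ge0}\mathcal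 A^k$, its Hilbert series is the formal power series $\mathrm{Hilb}\,\mathcal A(x)=\sum_{k\ge0}(\dim\mathcal A^k)x^k$. *)

theory Defs
  imports
    "HOL-Algebra.Embedded_Algebras"
    "HOL-Algebra.QuotRing"
    "HOL-Algebra.Algebraic_Closure_Type"
    "HOL-Library.Poly_Mapping"
    "HOL-Combinatorics.Permutations"
    "HOL-Computational_Algebra.Formal_Power_Series"
begin

section \<open>Circular peak sets\<close>

definition circ_peak_set :: "nat \<Rightarrow> (nat \<Rightarrow> nat) \<Rightarrow> nat set" where
  "circ_peak_set n \<sigma> = {\<sigma> i |i. i \<in> {2..n - 1} \<and> \<sigma> (i - 1) < \<sigma> i \<and> \<sigma> i > \<sigma> (i + 1)}"

definition perms_with_circ_peaks :: "nat \<Rightarrow> nat set \<Rightarrow> (nat \<Rightarrow> nat) set" where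
  "perms_with_circ_peaks n S = {\<sigma>. \<sigma> permutes {1..n} \<and> circ_peak_set n \<sigma> = S}"

definition circ_peak_poset :: "nat \<Rightarrow> nat set set" where
  "circ_peak_poset n = {S. S \<subseteq> {1..n} \<and> perms_with_circ_peaks n S \<noteq> {}}"


section \<open>Polynomials in the variables $x_1, \dots, x_m$\<close>

text \<open>
  A monomial is a finitely supported exponent function, and a polynomial is a finitely
  supported coefficient function on monomials; multiplication in this type is convolution.
  The type has a variable for every natural number, so that the ring in
  $x_1, \dots, x_m$ is cut out by its carrier.
\<close>

type_synonym 'k mpoly = "(nat \<Rightarrow>\<^sub>0 nat) \<Rightarrow>\<^sub>0 'k"

definition mpoly_ring :: "nat \<Rightarrow> 'k::field mpoly ring" where
  "mpoly_ring m =
     ring_of_type_algebra\<lparr>carrier := {p. \<forall>t \<in> Poly_Mapping.keys p. Poly_Mapping.keys t \<subseteq> {1..m}}\<rparr>"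

definition mvar :: "nat \<Rightarrow> 'k::field mpoly" where
  "mvar i = Poly_Mapping.single (Poly_Mapping.single i 1) 1"

definition mconst :: "'k::field \<Rightarrow> 'k mpoly" where
  "mconst c = Poly_Mapping.single 0 c"

definition monom_degree :: "(nat \<Rightarrow>\<^sub>0 nat) \<Rightarrow> nat" where
  "monom_degree t = (\<Sum>i \<in> Poly_Mapping.keys t. Poly_Mapping.lookup t i)"

definition homogeneous_polys :: "nat \<Rightarrow> nat \<Rightarrow> 'k::field mpoly set" where
  "homogeneous_polys m k =
     {p \<in> carrier (mpoly_ring m). \<forall>t \<in> Poly_Mapping.keys p. monom_degree t = k}"


section \<open>The algebra of a family of sets ordered by inclusion\<close>

text \<open>
  Throughout, \<open>S 1, \<dots>, S m\<close> enumerates the family.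
\<close>

definition incomparable_ideal :: "nat \<Rightarrow> (nat \<Rightarrow> nat set) \<Rightarrow> 'k::field mpoly set" where
  "incomparable_ideal m S =
     Idl\<^bsub>mpoly_ring m\<^esub> {mvar i * mvar j |i j.
       i \<in> {1..m} \<and> j \<in> {1..m} \<and> \<not> S i \<subseteq> S j \<and> \<not> S j \<subseteq> S i}"

definition poset_algebra :: "nat \<Rightarrow> (nat \<Rightarrow> nat set) \<Rightarrow> 'k::field mpoly set ring" where
  "poset_algebra m S = mpoly_ring m Quot incomparable_ideal m S"

definition poset_algebra_proj :: "nat \<Rightarrow> (nat \<Rightarrow> nat set) \<Rightarrow> 'k::field mpoly \<Rightarrow> 'k mpoly set" where
  "poset_algebra_proj m S p = incomparable_ideal m S +>\<^bsub>mpoly_ring m\<^esub> p"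

text \<open>The copy of the ground field inside the quotient, over which dimensions are taken.\<close>

definition poset_algebra_scalars :: "nat \<Rightarrow> (nat \<Rightarrow> nat set) \<Rightarrow> 'k::field mpoly set set" where
  "poset_algebra_scalars m S = range (\<lambda>c. poset_algebra_proj m S (mconst c))"

definition poset_algebra_graded :: "nat \<Rightarrow> (nat \<Rightarrow> nat set) \<Rightarrow> nat \<Rightarrow> 'k::field mpoly set set" where
  "poset_algebra_graded m S k = poset_algebra_proj m S ` homogeneous_polys m k"


section \<open>Hilbert series\<close>

text \<open>
  \<open>A\<close> is the algebra, \<open>K\<close> the ground field embedded in it, and \<open>G k\<close> its homogeneous
  component of degree \<open>k\<close>. The coefficients are taken in the rationals, where the
  recurrences with rational coefficients make sense, independently of the ground field.
\<close>

definition hilbert_series :: "('a, 'b) ring_scheme \<Rightarrow> 'a set \<Rightarrow> (nat \<Rightarrow> 'a set) \<Rightarrow> rat fps" where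
  "hilbert_series A K G = Abs_fps (\<lambda>k. of_nat (ring.dim A K (G k)))"

text \<open>
  The Hilbert series of the algebra of the circular peak poset, for a given
  enumeration \<open>S\<close> of that poset; the ground field only enters through its type.
\<close>

definition circ_peak_hilb :: "'k::field itself \<Rightarrow> nat \<Rightarrow> (nat \<Rightarrow> nat set) \<Rightarrow> rat fps" where
  "circ_peak_hilb _ n S =
     (let m = card (circ_peak_poset n) in
      hilbert_series (poset_algebra m S :: 'k mpoly set ring)
        (poset_algebra_scalars m S) (poset_algebra_graded m S))"

end

theory Submission
  imports Defs
begin

text \<open>
  A set \<open>S\<close> is a circular peak set iff for every \<open>j\<close> fewer than half of \<open>1, \<dots>, j\<close> lie in
  \<open>S\<close>, that is, iff \<open>S\<close> is the set of down steps of a ballot path. The monomials supported on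
  chains form a basis of the algebra, so its component of degree \<open>k\<close> has as dimension the
  number of multichains of length \<open>k\<close>; as the family is closed under subsets, this is the sum
  of \<open>k ^ card S\<close> over the family. Appending a step to a ballot path multiplies this sum by
  \<open>k + 1\<close>, except that paths of height zero (Catalan many) cannot go down; the
  ratio \<open>4n / (n + 3)\<close> of consecutive Catalan numbers gives the second recurrence.
\<close>

section \<open>Circular peak sets are ballot sets\<close>

text \<open>Let P_n(k) be the k-th coefficient of H_n. Since x d/dx multiplies it by k, x H' + H
  encodes the factor k + 1, and each recurrence becomes an identity between the numbers P_n(k).
  Counted from the start, the height after j steps is
  \<open>j - 2 * card (S \<inter> {1..j})\<close>, at least 1 and of the parity of j. For even n the
  final height is therefore at least 2 and both steps are available. For n = 2p + 1 the paths ending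
  at height 1 are blocked, which leaves a defect C_p k^(p+1), with C_p the Catalan number. The
  defect for n + 2 is C_(p+1) k^(p+2), that is, k C_(p+1) / C_p times the one for n. Expressing it
  through H_(n+1) and H_n brings in the earlier series, and the product k (k + 1) on P_n(k) brings
  in the second derivative.\<close>

lemma card_peaks_below:
  assumes \<sigma>: "\<sigma> permutes {1..n}" and j: "j \<in> {1..n}"
  shows "2 * card (circ_peak_set n \<sigma> \<inter> {1..j}) < j"
proof -
  define Q where "Q = {i \<in> {2..n - 1}. \<sigma> (i - 1) < \<sigma> i \<and> \<sigma> i > \<sigma> (i + 1) \<and> \<sigma> i \<le> j}"
  have inj: "inj \<sigma>" using \<sigma> by (rule permutes_inj)
  have fin: "finite Q" by (simp add: Q_def)
  have in_range: "\<sigma> i \<in> {1..n}" if "i \<in> {1..n}" for i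
    using permutes_in_image[OF \<sigma>, of i] that by simp
  have img: "circ_peak_set n \<sigma> \<inter> {1..j} = \<sigma> ` Q"
    using in_range by (fastforce simp: circ_peak_set_def Q_def)
  have card_img: "card (circ_peak_set n \<sigma> \<inter> {1..j}) = card Q"
    unfolding img by (rule card_image) (use inj in \<open>auto intro: inj_on_subset\<close>)
  show ?thesis
  proof (cases "Q = {}")
    case True
    with card_img j show ?thesis by simp
  next
    case False
    define q where "q = Min Q"
    have q: "q \<in> Q" "\<And>i. i \<in> Q \<Longrightarrow> q \<le> i" using False fin by (auto simp: q_def)
    \<comment> \<open>Two peaks are never adjacent, so peaks and their right neighbours are
      disjoint; the left neighbour of the leftmost peak is one position more. All entries at these 2
      * card Q + 1 positions are bounded by peak values, hence by j. The extra position makes the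
      inequality strict.\<close>
    define N where "N = insert (q - 1) (Q \<union> Suc ` Q)"
    have disj: "Q \<inter> Suc ` Q = {}"
    proof (rule ccontr)
      assume "Q \<inter> Suc ` Q \<noteq> {}"
      then obtain i where "i \<in> Q" "Suc i \<in> Q" by auto
      then show False by (auto simp: Q_def)
    qed
    have "q - 1 \<notin> Q \<union> Suc ` Q" using q by (force simp: Q_def)
    then have "card N = 2 * card Q + 1"
      using fin disj by (simp add: N_def card_Un_disjoint card_image)
    moreover have "card N \<le> card {1..j}"
    proof (rule card_inj_on_le)
      show "inj_on \<sigma> N" using inj by (auto intro: inj_on_subset)
      show "\<sigma> ` N \<subseteq> {1..j}"
      proof
        fix v assume "v \<in> \<sigma> ` N"
        then obtain i where i: "i \<in> N" "v = \<sigma> i" by auto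
        then have "i \<in> {1..n}" "\<sigma> i \<le> j"
          using q(1) by (auto simp: N_def Q_def)
        with in_range i show "v \<in> {1..j}" by auto
      qed
    qed simp
    ultimately show ?thesis using card_img by simp
  qed
qed

section \<open>Inserting a new maximum into a permutation\<close>

definition insert_max :: "nat \<Rightarrow> nat \<Rightarrow> (nat \<Rightarrow> nat) \<Rightarrow> nat \<Rightarrow> nat" where
  "insert_max n p \<sigma> i =
     (if i < p then \<sigma> i else if i = p then n + 1 else if i \<le> n + 1 then \<sigma> (i - 1) else i)"

lemma insert_max_permutes:
  assumes \<sigma>: "\<sigma> permutes {1..n}" and p: "p \<in> {1..n + 1}"
  shows "insert_max n p \<sigma> permutes {1..n + 1}"
proof (rule inj_imp_permutes)
  define d where "d i = (if i < p then i else i - 1)" for i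
  have in_range: "\<sigma> (d i) \<in> {1..n}" if "i \<in> {1..n + 1}" "i \<noteq> p" for i
  proof -
    have "d i \<in> {1..n}" using that p by (auto simp: d_def)
    with \<sigma> show ?thesis by (simp only: permutes_in_image)
  qed
  have eq: "insert_max n p \<sigma> i = (if i = p then n + 1 else \<sigma> (d i))" if "i \<in> {1..n + 1}" for i
    using that by (auto simp: insert_max_def d_def)
  show "inj_on (insert_max n p \<sigma>) {1..n + 1}"
  proof (rule inj_onI)
    fix i j assume ij: "i \<in> {1..n + 1}" "j \<in> {1..n + 1}"
      and "insert_max n p \<sigma> i = insert_max n p \<sigma> j"
    then have "(if i = p then n + 1 else \<sigma> (d i)) = (if j = p then n + 1 else \<sigma> (d j))"
      by (simp only: eq)
    then have "i = p \<and> j = p \<or> i \<noteq> p \<and> j \<noteq> p \<and> \<sigma> (d i) = \<sigma> (d j)"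
      using in_range[OF ij(1)] in_range[OF ij(2)] by (auto split: if_splits)
    moreover have "i = j" if "i \<noteq> p" "j \<noteq> p" "d i = d j"
      using that by (auto simp: d_def split: if_splits)
    ultimately show "i = j" using permutes_inj[OF \<sigma>] by (blast dest: injD)
  qed
  show "insert_max n p \<sigma> i \<in> {1..n + 1}" if "i \<in> {1..n + 1}" for i
    using in_range[OF that] by (auto simp: eq[OF that])
  show "insert_max n p \<sigma> i = i" if "i \<notin> {1..n + 1}" for i
    using that p \<sigma> by (auto simp: insert_max_def permutes_def)
qed simp

text \<open>Circular peak sets consist of values, whereas the inductive construction has to control
  the positions of the peaks.\<close>

definition peak_at :: "nat \<Rightarrow> (nat \<Rightarrow> nat) \<Rightarrow> nat \<Rightarrow> bool" where
  "peak_at n \<sigma> i \<longleftrightarrow> i \<in> {2..n - 1} \<and> \<sigma> (i - 1) < \<sigma> i \<and> \<sigma> i > \<sigma> (i + 1)"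

lemma circ_peak_set_eq: "circ_peak_set n \<sigma> = \<sigma> ` {i. peak_at n \<sigma> i}"
  by (auto simp: circ_peak_set_def peak_at_def)

definition ballot_sets :: "nat \<Rightarrow> nat set set" where
  "ballot_sets n = {S. S \<subseteq> {1..n} \<and> (\<forall>j\<in>{1..n}. 2 * card (S \<inter> {1..j}) < j)}"

lemma ballot_sets_0: "ballot_sets 0 = {{}}"
  by (auto simp: ballot_sets_def)

lemma ballot_sets_finite [simp]: "finite (ballot_sets n)"
  by (rule finite_subset[of _ "Pow {1..n}"]) (auto simp: ballot_sets_def)

text \<open>For n = 0 the prefix condition is vacuous and the empty set violates 2 * card S < n; the
  bound by \<open>Suc n\<close> is the form that holds for every n.\<close>

lemma ballot_setsD:
  assumes "S \<in> ballot_sets n"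
  shows "S \<subseteq> {1..n}" "finite S" "2 * card S < Suc n" "n > 0 \<Longrightarrow> 2 * card S < n"
proof -
  show sub: "S \<subseteq> {1..n}" using assms by (simp add: ballot_sets_def)
  then show "finite S" by (rule finite_subset) simp
  have "S \<inter> {1..n} = S" using sub by auto
  moreover have "\<forall>j\<in>{1..n}. 2 * card (S \<inter> {1..j}) < j"
    using assms by (simp add: ballot_sets_def)
  ultimately show *: "n > 0 \<Longrightarrow> 2 * card S < n" by (auto dest: bspec[of _ _ n])
  show "2 * card S < Suc n"
    using sub * by (cases "n = 0") auto
qed

text \<open>Only the prefix of length \<open>Suc n\<close> is a new condition. It is automatic if
  \<open>Suc n\<close> is left out; if it is added to T, the condition reads 2 * (card T + 1) < n +
  1.\<close>

lemma ballot_sets_Suc: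
  "ballot_sets (Suc n) =
     ballot_sets n \<union> insert (Suc n) ` {S \<in> ballot_sets n. 2 * card S + 1 < n}"
proof (intro equalityI subsetI)
  fix S assume S: "S \<in> ballot_sets (Suc n)"
  define S' where "S' = S - {Suc n}"
  have sub: "S' \<subseteq> {1..n}" using S by (fastforce simp: S'_def ballot_sets_def)
  have "S' \<inter> {1..j} = S \<inter> {1..j}" if "j \<in> {1..n}" for j
    using that by (auto simp: S'_def)
  then have S': "S' \<in> ballot_sets n" using S sub by (auto simp: ballot_sets_def)
  show "S \<in> ballot_sets n \<union> insert (Suc n) ` {S \<in> ballot_sets n. 2 * card S + 1 < n}"
  proof (cases "Suc n \<in> S")
    case True
    then have eq: "S = insert (Suc n) S'" by (auto simp: S'_def)
    have "finite S'" using sub by (rule finite_subset) simp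
    then have "card S = Suc (card S')"
      using sub unfolding eq by (subst card_insert_disjoint) auto
    moreover have "S \<inter> {1..Suc n} = S" using S by (auto simp: ballot_sets_def)
    moreover have "2 * card (S \<inter> {1..Suc n}) < Suc n" using S by (auto simp: ballot_sets_def)
    ultimately have "2 * card S' + 1 < n" by simp
    with eq S' show ?thesis by auto
  next
    case False
    then have "S' = S" by (simp add: S'_def)
    with S' show ?thesis by simp
  qed
next
  fix S assume "S \<in> ballot_sets n \<union> insert (Suc n) ` {S \<in> ballot_sets n. 2 * card S + 1 < n}"
  then obtain T where T: "T \<in> ballot_sets n"
    and S: "S = T \<or> S = insert (Suc n) T \<and> 2 * card T + 1 < n" by auto
  note T_sub = ballot_setsD(1)[OF T] and fin = ballot_setsD(2)[OF T]
  have cS: "2 * card S < Suc n"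
    using S fin ballot_setsD(3)[OF T] by (auto simp: card_insert_if)
  have sub: "S \<subseteq> {1..Suc n}" using S T_sub by auto
  moreover have "2 * card (S \<inter> {1..j}) < j" if "j \<in> {1..Suc n}" for j
  proof (cases "j = Suc n")
    case True
    then have "S \<inter> {1..j} = S" using sub by auto
    with cS True show ?thesis by simp
  next
    case False
    with S that have "S \<inter> {1..j} = T \<inter> {1..j}" by auto
    with T False that show ?thesis by (auto simp: ballot_sets_def)
  qed
  ultimately show "S \<in> ballot_sets (Suc n)" by (auto simp: ballot_sets_def)
qed

lemma ballot_sets_downward: "S \<in> ballot_sets n \<Longrightarrow> T \<subseteq> S \<Longrightarrow> T \<in> ballot_sets n"
  unfolding ballot_sets_def
proof safe
  fix j assume "T \<subseteq> S" "\<forall>j\<in>{1..n}. 2 * card (S \<inter> {1..j}) < j" "j \<in> {1..n}"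
  moreover from this have "card (T \<inter> {1..j}) \<le> card (S \<inter> {1..j})"
    by (intro card_mono) auto
  ultimately show "2 * card (T \<inter> {1..j}) < j" by (meson le_less_trans mult_le_mono2)
qed auto

lemma empty_in_ballot_sets: "{} \<in> ballot_sets n"
  by (simp add: ballot_sets_def)

text \<open>
  Keeping all peaks at the even positions \<open>2, \<dots>, 2 * card S\<close> leaves a fixed place, position
  \<open>2 * card S + 2\<close>, where a new maximum becomes a peak without destroying an old one.
\<close>

lemma ballot_set_realized:
  assumes "S \<in> ballot_sets n"
  shows "\<exists>\<sigma>. \<sigma> permutes {1..n} \<and> circ_peak_set n \<sigma> = S \<and>
           (\<forall>i. peak_at n \<sigma> i \<longleftrightarrow> even i \<and> i \<in> {2..2 * card S})"
  using assms
proof (induction n arbitrary: S)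
  case 0
  then have "S = {}" by (simp add: ballot_sets_0)
  then show ?case by (intro exI[of _ id]) (auto simp: circ_peak_set_def peak_at_def permutes_def)
next
  case (Suc n)
  from Suc.prems consider "S \<in> ballot_sets n"
    | T where "S = insert (Suc n) T" "T \<in> ballot_sets n" "2 * card T + 1 < n"
    by (auto simp: ballot_sets_Suc)
  then show ?case
  proof cases
    case 1
    from Suc.IH[OF 1] obtain \<sigma> where \<sigma>: "\<sigma> permutes {1..n}" "circ_peak_set n \<sigma> = S"
      and peaks: "\<And>i. peak_at n \<sigma> i \<longleftrightarrow> even i \<and> i \<in> {2..2 * card S}" by auto
    have in_range: "1 \<le> \<sigma> i \<and> \<sigma> i \<le> n" if "1 \<le> i" "i \<le> n" for i
      using permutes_in_image[OF \<sigma>(1), of i] that by simp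
    \<comment> \<open>The unchanged permutation fixes \<open>Suc n\<close>, so its word ends with a
      larger new entry and position n, now interior, is no peak.\<close>
    have last: "\<sigma> (Suc n) = Suc n" using \<sigma>(1) by (simp add: permutes_def)
    have same: "peak_at (Suc n) \<sigma> i = peak_at n \<sigma> i" for i
    proof (cases "i = n")
      case True
      then show ?thesis using last in_range[of n] by (auto simp: peak_at_def)
    next
      case False
      then show ?thesis by (auto simp: peak_at_def)
    qed
    have "\<sigma> permutes {1..Suc n}" using \<sigma>(1) by (rule permutes_subset) auto
    moreover have "circ_peak_set (Suc n) \<sigma> = S"
      using \<sigma>(2) by (simp only: circ_peak_set_eq same)
    ultimately show ?thesis using peaks by (intro exI[of _ \<sigma>]) (simp only: same, simp)
  next
    case (2 T)
    from Suc.IH[OF 2(2)] obtain \<sigma> where \<sigma>: "\<sigma> permutes {1..n}" "circ_peak_set n \<sigma> = T"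
      and peaks: "\<And>i. peak_at n \<sigma> i \<longleftrightarrow> even i \<and> i \<in> {2..2 * card T}" by auto
    have in_range: "1 \<le> \<sigma> i \<and> \<sigma> i \<le> n" if "1 \<le> i" "i \<le> n" for i
      using permutes_in_image[OF \<sigma>(1), of i] that by simp
    define p where "p = 2 * card T + 2"
    define \<tau> where "\<tau> = insert_max n p \<sigma>"
    \<comment> \<open>The ballot bound says exactly that position p is interior in the word of
      length \<open>Suc n\<close>, so that the new maximum has a right neighbour.\<close>
    have p: "p \<in> {2..n}" using 2(3) by (simp add: p_def)
    have perm: "\<tau> permutes {1..Suc n}"
      using insert_max_permutes[OF \<sigma>(1), of p] p by (simp add: \<tau>_def)
    have "card S = Suc (card T)"
      using 2(1) ballot_setsD(1,2)[OF 2(2)] by (force simp: card_insert_if)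
    have peak_\<tau>: "peak_at (Suc n) \<tau> i \<longleftrightarrow> i = p \<or> peak_at n \<sigma> i" for i
    proof -
      \<comment> \<open>Positions p - 1 and p + 1 exceed 2 * card T, so they were no peaks, and next
        to the new maximum they cannot become peaks. Beyond p + 1 the entries are shifted by one: a
        peak of \<open>\<tau>\<close> at i would be a peak of \<open>\<sigma>\<close> at i - 1,
        which is too far right.\<close>
      consider "i = 0" | "0 < i" "i < p - 1" | "i = p - 1" | "i = p" | "i = p + 1" | "i > p + 1" by linarith
      then show ?thesis
      proof cases
        case 1 then show ?thesis using p by (simp add: peak_at_def)
      next
        case 2 then show ?thesis using p by (auto simp: peak_at_def \<tau>_def insert_max_def)
      next
        case 3
        have "\<not> peak_at n \<sigma> i" using 3 by (simp add: peaks p_def)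
        moreover have "\<not> peak_at (Suc n) \<tau> i"
          using 3 p in_range[of i] by (auto simp: peak_at_def \<tau>_def insert_max_def)
        ultimately show ?thesis using 3 p by auto
      next
        case 4
        have "\<sigma> (p - 1) \<le> n" "\<sigma> p \<le> n" using in_range[of "p - 1"] in_range[of p] p by auto
        then have "peak_at (Suc n) \<tau> p"
          using p by (simp add: peak_at_def \<tau>_def insert_max_def)
        with 4 show ?thesis by simp
      next
        case 5
        have "\<sigma> p \<le> n" using in_range[of p] p by auto
        then have "\<not> peak_at (Suc n) \<tau> i"
          using 5 p by (simp add: peak_at_def \<tau>_def insert_max_def)
        moreover have "\<not> peak_at n \<sigma> i" using 5 by (simp add: peaks p_def)
        ultimately show ?thesis using 5 by simp
      next
        case 6
        then have "\<not> peak_at n \<sigma> i" by (simp add: peaks p_def)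
        have "2 * card T < i - 1" using 6 by (simp add: p_def)
        then have "\<not> peak_at n \<sigma> (i - 1)" by (simp add: peaks)
        moreover have "peak_at n \<sigma> (i - 1)" if "peak_at (Suc n) \<tau> i"
        proof -
          from that have i: "i \<le> n" "\<tau> (i - 1) < \<tau> i" "\<tau> i > \<tau> (i + 1)"
            by (auto simp: peak_at_def)
          moreover have "\<tau> x = \<sigma> (x - 1)" if "p < x" "x \<le> n + 1" for x
            using that by (simp add: \<tau>_def insert_max_def)
          from this[of "i - 1"] this[of i] this[of "i + 1"]
          have "\<tau> (i - 1) = \<sigma> (i - 1 - 1)" "\<tau> i = \<sigma> (i - 1)" "\<tau> (i + 1) = \<sigma> i"
            using 6 i(1) by simp_all
          ultimately have "\<sigma> (i - 1 - 1) < \<sigma> (i - 1)" "\<sigma> (i - 1) > \<sigma> i"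
            by simp_all
          moreover have "2 \<le> i - 1" "i - 1 \<le> n - 1" "i - 1 + 1 = i" using i 6 p by auto
          ultimately show ?thesis by (simp add: peak_at_def)
        qed
        ultimately have "\<not> peak_at (Suc n) \<tau> i" by blast
        with \<open>\<not> peak_at n \<sigma> i\<close> 6 show ?thesis by simp
      qed
    qed
    \<comment> \<open>All old peaks lie to the left of p, where the insertion leaves the entries
      alone.\<close>
    have "\<tau> ` {i. peak_at n \<sigma> i} = \<sigma> ` {i. peak_at n \<sigma> i}"
      by (intro image_cong refl) (auto simp: peaks \<tau>_def insert_max_def p_def)
    moreover have "\<tau> p = Suc n" by (simp add: \<tau>_def insert_max_def)
    moreover have "{i. peak_at (Suc n) \<tau> i} = insert p {i. peak_at n \<sigma> i}"
      using peak_\<tau> by auto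
    ultimately have "circ_peak_set (Suc n) \<tau> = S"
      using \<sigma>(2) 2(1) by (simp add: circ_peak_set_eq)
    moreover have "peak_at (Suc n) \<tau> i \<longleftrightarrow> even i \<and> i \<in> {2..2 * card S}" for i
    proof -
      have "even i \<Longrightarrow> i \<le> 2 * card T + 2 \<longleftrightarrow> i = 2 * card T + 2 \<or> i \<le> 2 * card T"
        by presburger
      then show ?thesis
        unfolding peak_\<tau> peaks \<open>card S = Suc (card T)\<close> p_def by auto
    qed
    ultimately show ?thesis using perm by (intro exI[of _ \<tau>] conjI allI)
  qed
qed

lemma circ_peak_poset_eq: "circ_peak_poset n = ballot_sets n"
proof (intro equalityI subsetI)
  fix S assume "S \<in> circ_peak_poset n"
  then obtain \<sigma> where "\<sigma> permutes {1..n}" "circ_peak_set n \<sigma> = S" "S \<subseteq> {1..n}"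
    by (auto simp: circ_peak_poset_def perms_with_circ_peaks_def)
  then show "S \<in> ballot_sets n"
    using card_peaks_below[of \<sigma> n] by (simp only: ballot_sets_def) simp
next
  fix S assume S: "S \<in> ballot_sets n"
  then obtain \<sigma> where "\<sigma> \<in> perms_with_circ_peaks n S"
    using ballot_set_realized[OF S] by (auto simp: perms_with_circ_peaks_def)
  then show "S \<in> circ_peak_poset n"
    using ballot_setsD(1)[OF S] by (auto simp: circ_peak_poset_def)
qed

section \<open>Counting ballot sets\<close>

lemma card_filter_eq_sum: "finite A \<Longrightarrow> card {x \<in> A. P x} = (\<Sum>x\<in>A. if P x then 1 else 0)"
  unfolding card_eq_sum by (rule sum.inter_filter)

text \<open>The weight g is left general because two are needed: an indicator yields the recursion
  for counts by size, a power of k the one for \<open>ballot_poly\<close>.\<close>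

lemma sum_ballot_sets_Suc:
  fixes g :: "nat \<Rightarrow> 'a::comm_monoid_add"
  shows "(\<Sum>S\<in>ballot_sets (Suc n). g (card S)) =
    (\<Sum>S\<in>ballot_sets n. g (card S)) + (\<Sum>S | S \<in> ballot_sets n \<and> 2 * card S + 1 < n. g (Suc (card S)))"
proof -
  let ?T = "{S \<in> ballot_sets n. 2 * card S + 1 < n}"
  have new: "Suc n \<notin> S" if "S \<in> ballot_sets n" for S
    using ballot_setsD(1)[OF that] by auto
  have "inj_on (insert (Suc n)) ?T"
    using new by (intro inj_onI) (simp add: insert_ident)
  moreover have "card (insert (Suc n) S) = Suc (card S)" if "S \<in> ?T" for S
    using that new ballot_setsD(2) by (intro card_insert_disjoint) auto
  ultimately have "(\<Sum>S\<in>insert (Suc n) ` ?T. g (card S)) = (\<Sum>S\<in>?T. g (Suc (card S)))"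
    by (simp add: sum.reindex)
  moreover have "ballot_sets n \<inter> insert (Suc n) ` ?T = {}" using new by auto
  ultimately show ?thesis
    unfolding ballot_sets_Suc by (subst sum.union_disjoint) simp_all
qed

section \<open>Ballot numbers and Catalan numbers\<close>

definition ballot_count :: "nat \<Rightarrow> nat \<Rightarrow> nat" where
  "ballot_count n i = card {S \<in> ballot_sets n. card S = i}"

lemma ballot_count_eq_sum: "ballot_count n i = (\<Sum>S\<in>ballot_sets n. if card S = i then 1 else 0)"
  by (simp add: ballot_count_def card_filter_eq_sum)

lemma ballot_count_0_right [simp]: "ballot_count n 0 = 1"
proof -
  have "{S \<in> ballot_sets n. card S = 0} = {{}}"
    using empty_in_ballot_sets[of n] ballot_setsD(2)[of _ n] by auto
  then show ?thesis by (simp add: ballot_count_def)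
qed

lemma ballot_count_eq_0:
  assumes "0 < n" "n \<le> 2 * i"
  shows "ballot_count n i = 0"
proof -
  have "card S \<noteq> i" if "S \<in> ballot_sets n" for S
    using assms ballot_setsD(4)[OF that] by simp
  then have "{S \<in> ballot_sets n. card S = i} = {}" by blast
  then show ?thesis by (simp add: ballot_count_def)
qed

lemma ballot_count_Suc_Suc:
  "ballot_count (Suc n) (Suc i) =
     ballot_count n (Suc i) + (if 2 * i + 1 < n then ballot_count n i else 0)"
proof -
  have "(\<Sum>S | S \<in> ballot_sets n \<and> 2 * card S + 1 < n. if card S = i then 1 else 0 :: nat) =
      (\<Sum>S\<in>ballot_sets n. if 2 * card S + 1 < n then if card S = i then 1 else 0 else 0)"
    by (simp add: sum.inter_filter)
  also have "\<dots> = (if 2 * i + 1 < n then ballot_count n i else 0)"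
    unfolding ballot_count_eq_sum
    by (cases "2 * i + 1 < n") (auto intro!: sum.cong sum.neutral)
  finally show ?thesis
    using sum_ballot_sets_Suc[of "\<lambda>c. if c = Suc i then 1 else 0 :: nat" n]
    by (simp add: ballot_count_eq_sum)
qed

text \<open>This is the difference of binomials known from the reflection principle, written as a
  sum to avoid truncated subtraction. Pascal's rule replaces the reflection in the
  induction.\<close>

lemma ballot_count_formula:
  assumes "2 * Suc i \<le> Suc n"
  shows "ballot_count (Suc n) (Suc i) + (n choose i) = n choose Suc i"
  using assms
proof (induction n arbitrary: i)
  case 0
  then show ?case by simp
next
  case (Suc n)
  show ?case
  proof (cases "2 * Suc i \<le> Suc n")
    case True
    \<comment> \<open>The case expression is n choose (i - 1), with value 0 at i = 0, where i - 1
      would be truncated.\<close>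
    have "ballot_count (Suc n) i + (case i of 0 \<Rightarrow> 0 | Suc i' \<Rightarrow> n choose i') = n choose i"
      using Suc.IH[of "i - 1"] True by (cases i) auto
    moreover have "Suc n choose i = (n choose i) + (case i of 0 \<Rightarrow> 0 | Suc i' \<Rightarrow> n choose i')"
      by (cases i) auto
    ultimately show ?thesis
      using Suc.IH[OF True] True by (simp add: ballot_count_Suc_Suc[of "Suc n"])
  next
    case False
    \<comment> \<open>On the boundary the count vanishes and both binomials are the equal middle
      entries of row 2 * i + 1.\<close>
    with Suc.prems have n: "n = 2 * i" by simp
    then have "ballot_count (Suc (Suc n)) (Suc i) = 0" by (intro ballot_count_eq_0) simp_all
    moreover have "Suc n choose i = Suc n choose Suc i"
      using n binomial_symmetric[of i "Suc n"] by simp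
    ultimately show ?thesis by simp
  qed
qed

text \<open>These are the Catalan numbers. For p = q + 1, absorption turns (q + 2) times the
  subtracted binomial into q + 1 times the central one, so exactly one central binomial is
  left.\<close>

lemma ballot_count_central: "Suc p * ballot_count (2 * p + 1) p = (2 * p) choose p"
proof (cases p)
  case (Suc q)
  let ?n = "2 * q + 2"
  have "ballot_count (?n + 1) (Suc q) + (?n choose q) = ?n choose Suc q"
    using ballot_count_formula[of q ?n] by simp
  then have "(q + 2) * ballot_count (?n + 1) (Suc q) + (q + 2) * (?n choose q) = (q + 2) * (?n choose Suc q)"
    by (metis distrib_left)
  moreover have "(q + 2) * (?n choose q) = ?n * ((?n - 1) choose q)"
    using binomial_absorb_comp[of ?n q] by simp
  moreover have "Suc q * (?n choose Suc q) = ?n * ((?n - 1) choose q)"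
    using binomial_absorption[of q ?n] by simp
  ultimately show ?thesis using Suc by (simp add: algebra_simps)
qed simp

lemma central_binomial_Suc:
  "Suc p * ((2 * p + 2) choose Suc p) = 2 * (2 * p + 1) * ((2 * p) choose p)"
proof -
  have "Suc p * ((2 * p + 2) choose Suc p) = (2 * p + 2) * ((2 * p + 1) choose p)"
    using binomial_absorption[of p "2 * p + 2"] by simp
  also have "\<dots> = 2 * (Suc p * ((2 * p + 1) choose p))" by simp
  also have "Suc p * ((2 * p + 1) choose p) = (2 * p + 1) * ((2 * p) choose p)"
    using binomial_absorb_comp[of "2 * p + 1" p] by simp
  finally show ?thesis by simp
qed

text \<open>The Catalan recurrence. For n = 2p + 1 the ratio 2 (2p + 1) / (p + 2) is 4n / (n + 3),
  the constant in the odd case of the theorem.\<close>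

lemma ballot_count_central_Suc:
  "(p + 2) * ballot_count (2 * p + 3) (Suc p) = 2 * (2 * p + 1) * ballot_count (2 * p + 1) p"
proof -
  have "Suc p * ((p + 2) * ballot_count (2 * p + 3) (Suc p)) = Suc p * ((2 * p + 2) choose Suc p)"
    using ballot_count_central[of "Suc p"] by (simp add: numeral_3_eq_3)
  also have "\<dots> = 2 * (2 * p + 1) * (Suc p * ballot_count (2 * p + 1) p)"
    by (simp only: central_binomial_Suc ballot_count_central)
  also have "\<dots> = Suc p * (2 * (2 * p + 1) * ballot_count (2 * p + 1) p)"
    by (simp only: mult.left_commute)
  finally show ?thesis by (simp only: mult_cancel1) simp
qed

text \<open>The generating polynomial of ballot sets by size, evaluated at k; it will be the
  dimension in degree k. At k = 0 the empty set contributes 0 ^ 0 = 1, as degree 0 requires.\<close>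

definition ballot_poly :: "nat \<Rightarrow> nat \<Rightarrow> nat" where
  "ballot_poly n k = (\<Sum>S\<in>ballot_sets n. k ^ card S)"

lemma ballot_poly_Suc:
  "ballot_poly (Suc n) k =
     ballot_poly n k + k * (\<Sum>S | S \<in> ballot_sets n \<and> 2 * card S + 1 < n. k ^ card S)"
  using sum_ballot_sets_Suc[of "\<lambda>c. k ^ c" n] by (simp add: ballot_poly_def sum_distrib_left)

text \<open>By parity 2 * card S is at most n - 2, so every ballot set can be extended by
  \<open>Suc n\<close>.\<close>

lemma ballot_poly_even:
  assumes "even n" "0 < n"
  shows "ballot_poly (Suc n) k = (k + 1) * ballot_poly n k"
proof -
  have "2 * card S + 1 < n" if "S \<in> ballot_sets n" for S
    using ballot_setsD(4)[OF that] assms by presburger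
  then have "{S. S \<in> ballot_sets n \<and> 2 * card S + 1 < n} = ballot_sets n" by auto
  then show ?thesis by (simp add: ballot_poly_Suc) (simp add: ballot_poly_def)
qed

text \<open>Only the sets of size p cannot be extended; each of them would have contributed k * k ^
  p.\<close>

lemma ballot_poly_odd:
  "ballot_poly (2 * p + 2) k + ballot_count (2 * p + 1) p * k ^ Suc p = (k + 1) * ballot_poly (2 * p + 1) k"
proof -
  let ?n = "2 * p + 1"
  let ?T = "{S. S \<in> ballot_sets ?n \<and> 2 * card S + 1 < ?n}"
  let ?U = "{S \<in> ballot_sets ?n. card S = p}"
  have "2 * card S + 1 < ?n \<or> card S = p" if "S \<in> ballot_sets ?n" for S
    using ballot_setsD(4)[OF that] by linarith
  then have "ballot_sets ?n = ?T \<union> ?U" by blast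
  then have "ballot_poly ?n k = (\<Sum>S\<in>?T \<union> ?U. k ^ card S)" by (simp add: ballot_poly_def)
  also have "\<dots> = (\<Sum>S\<in>?T. k ^ card S) + (\<Sum>S\<in>?U. k ^ card S)"
    by (rule sum.union_disjoint) auto
  also have "(\<Sum>S\<in>?U. k ^ card S) = ballot_count ?n p * k ^ p"
    by (simp add: ballot_count_def)
  finally have "k * ballot_poly ?n k = k * (\<Sum>S\<in>?T. k ^ card S) + ballot_count ?n p * k ^ Suc p"
    by (simp add: algebra_simps)
  with ballot_poly_Suc[of ?n k] show ?thesis by simp
qed

text \<open>The last bracket is minus the defect for n; multiplied by k and the ratio of consecutive
  Catalan numbers it becomes minus the defect for n + 2.\<close>

lemma ballot_poly_three_term:
  assumes "odd n"
  shows "of_nat (ballot_poly (n + 3) k) =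
    (of_nat k + 1) * of_nat (ballot_poly (n + 2) k) +
    (4 * of_nat n / of_nat (n + 3)) * of_nat k *
      (of_nat (ballot_poly (n + 1) k) - (of_nat k + 1) * of_nat (ballot_poly n k) :: 'a::field_char_0)"
proof -
  from assms obtain p where p: "n = 2 * p + 1" by (rule oddE)
  define c d where "c = ballot_count (2 * p + 1) p" and "d = ballot_count (2 * p + 3) (Suc p)"
  have "of_nat (ballot_poly (n + 1) k) + of_nat c * of_nat k ^ Suc p = (of_nat k + 1 :: 'a) * of_nat (ballot_poly n k)"
    using arg_cong[OF ballot_poly_odd[of p k], of "of_nat :: nat \<Rightarrow> 'a"] by (simp add: p c_def algebra_simps)
  then have 1: "of_nat (ballot_poly (n + 1) k) - (of_nat k + 1) * of_nat (ballot_poly n k) = - (of_nat c * of_nat k ^ Suc p :: 'a)"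
    by (simp add: algebra_simps)
  have "2 * Suc p + 2 = n + 3" "2 * Suc p + 1 = n + 2" "2 * p + 3 = n + 2" using p by simp_all
  then have "of_nat (ballot_poly (n + 3) k) + of_nat d * of_nat k ^ Suc (Suc p) = (of_nat k + 1 :: 'a) * of_nat (ballot_poly (n + 2) k)"
    using arg_cong[OF ballot_poly_odd[of "Suc p" k], of "of_nat :: nat \<Rightarrow> 'a"]
    by (simp only: d_def of_nat_add of_nat_mult of_nat_power of_nat_1)
  then have 2: "of_nat (ballot_poly (n + 3) k) = (of_nat k + 1 :: 'a) * of_nat (ballot_poly (n + 2) k) - of_nat d * of_nat k ^ Suc (Suc p)"
    by (simp add: algebra_simps)
  have "(n + 3) * d = 4 * n * c"
    using ballot_count_central_Suc[of p] by (simp add: p c_def d_def algebra_simps)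
  then have "of_nat (n + 3) * of_nat d = (4 * of_nat n * of_nat c :: 'a)"
    by (metis of_nat_mult of_nat_numeral)
  moreover have "of_nat (n + 3) \<noteq> (0 :: 'a)" by (simp only: of_nat_eq_0_iff)
  ultimately have "of_nat d = (4 * of_nat n / of_nat (n + 3) * of_nat c :: 'a)"
    by (simp add: field_simps del: of_nat_add)
  then show ?thesis unfolding 1 2 by simp
qed

lemma ballot_poly_3: "ballot_poly 3 k = k + 1"
proof -
  have "ballot_poly 0 k = 1" by (simp add: ballot_poly_def ballot_sets_0)
  then have "ballot_poly 1 k = 1" using ballot_poly_Suc[of 0 k] by simp
  then have "ballot_poly 2 k = 1" using ballot_poly_Suc[of 1 k] by (simp add: numeral_2_eq_2)
  then show ?thesis using ballot_poly_even[of 2 k] by (simp add: numeral_3_eq_3 numeral_2_eq_2)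
qed

lemma ballot_poly_4: "ballot_poly 4 k = 2 * k + 1"
proof -
  have "ballot_count 3 1 = 1" using ballot_count_central[of 1] by (simp add: numeral_3_eq_3)
  moreover have "2 * 1 + 2 = (4 :: nat)" "2 * 1 + 1 = (3 :: nat)" by simp_all
  ultimately have "ballot_poly 4 k + k ^ Suc 1 = (k + 1) * (k + 1)"
    using ballot_poly_odd[of 1 k] by (simp only: ballot_poly_3 mult_1)
  then show ?thesis by simp
qed

section \<open>A monomial basis of the algebra\<close>

text \<open>Natural exponents cannot cancel, so equality holds where general coefficients give only
  an inclusion.\<close>

lemma keys_plus_nat:
  fixes s t :: "'a \<Rightarrow>\<^sub>0 nat"
  shows "Poly_Mapping.keys (s + t) = Poly_Mapping.keys s \<union> Poly_Mapping.keys t"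
  by (auto simp: in_keys_iff lookup_add)

lemma poly_mapping_eq_sum_single:
  "p = (\<Sum>t\<in>Poly_Mapping.keys p. Poly_Mapping.single t (Poly_Mapping.lookup p t))"
proof (rule poly_mapping_eqI)
  fix s
  have "(\<Sum>t\<in>Poly_Mapping.keys p. Poly_Mapping.lookup p t when t = s) = Poly_Mapping.lookup p s"
    by (simp add: when_def in_keys_iff)
  then show "Poly_Mapping.lookup p s =
      Poly_Mapping.lookup (\<Sum>t\<in>Poly_Mapping.keys p. Poly_Mapping.single t (Poly_Mapping.lookup p t)) s"
    by (simp add: lookup_sum lookup_single)
qed

section \<open>The polynomial ring in finitely many variables\<close>

lemma mpoly_ring_simps [simp]:
  "p \<in> carrier (mpoly_ring m) \<longleftrightarrow>
     (\<forall>t\<in>Poly_Mapping.keys p. Poly_Mapping.keys t \<subseteq> {1..m})"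
  "p \<otimes>\<^bsub>mpoly_ring m\<^esub> q = p * q"
  "p \<oplus>\<^bsub>mpoly_ring m\<^esub> q = p + q"
  "\<one>\<^bsub>mpoly_ring m\<^esub> = 1"
  "\<zero>\<^bsub>mpoly_ring m\<^esub> = 0"
  by (simp_all add: mpoly_ring_def ring_of_type_algebra_def)

lemma mpoly_ring_add_closed:
  "p \<in> carrier (mpoly_ring m) \<Longrightarrow> q \<in> carrier (mpoly_ring m) \<Longrightarrow> p + q \<in> carrier (mpoly_ring m)"
  using Poly_Mapping.keys_add[of p q] by fastforce

lemma mpoly_ring_mult_closed:
  assumes "p \<in> carrier (mpoly_ring m)" "q \<in> carrier (mpoly_ring m)"
  shows "p * q \<in> carrier (mpoly_ring m)"
  unfolding mpoly_ring_simps
proof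
  fix t assume "t \<in> Poly_Mapping.keys (p * q)"
  then obtain a b where "t = a + b" "a \<in> Poly_Mapping.keys p" "b \<in> Poly_Mapping.keys q"
    using keys_mult[of p q] by blast
  with assms show "Poly_Mapping.keys t \<subseteq> {1..m}" by (simp add: keys_plus_nat)
qed

lemma keys_uminus_poly: "Poly_Mapping.keys (- p) = Poly_Mapping.keys (p :: 'a \<Rightarrow>\<^sub>0 'b::ab_group_add)"
  by (auto simp: in_keys_iff)

lemma cring_mpoly_ring: "cring (mpoly_ring m :: 'k::field mpoly ring)"
proof (rule cringI)
  show "abelian_group (mpoly_ring m :: 'k mpoly ring)"
  proof (rule abelian_groupI)
    fix p :: "'k mpoly" assume "p \<in> carrier (mpoly_ring m)"
    then show "\<exists>q\<in>carrier (mpoly_ring m). q \<oplus>\<^bsub>mpoly_ring m\<^esub> p = \<zero>\<^bsub>mpoly_ring m\<^esub>"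
      by (intro bexI[of _ "- p"]) (simp_all add: keys_uminus_poly)
  qed (use mpoly_ring_add_closed in \<open>auto simp only: mpoly_ring_simps(2-5) add_ac\<close>, simp_all)
  show "comm_monoid (mpoly_ring m :: 'k mpoly ring)"
    by (rule comm_monoidI)
      (use mpoly_ring_mult_closed in \<open>auto simp only: mpoly_ring_simps(2-5) mult_ac\<close>, simp_all)
qed (simp add: distrib_right)

lemma mpoly_ring_minus [simp]:
  assumes "p \<in> carrier (mpoly_ring m)" "q \<in> carrier (mpoly_ring m)"
  shows "p \<ominus>\<^bsub>mpoly_ring m\<^esub> q = p - q"
proof -
  interpret R: cring "mpoly_ring m" by (rule cring_mpoly_ring)
  have "\<ominus>\<^bsub>mpoly_ring m\<^esub> q = - q"
    using assms by (intro R.minus_equality) (simp_all add: keys_uminus_poly)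
  then show ?thesis by (simp add: a_minus_def)
qed

definition chain_monomial :: "(nat \<Rightarrow> 'a set) \<Rightarrow> (nat \<Rightarrow>\<^sub>0 nat) \<Rightarrow> bool" where
  "chain_monomial S t \<longleftrightarrow>
     (\<forall>i\<in>Poly_Mapping.keys t. \<forall>j\<in>Poly_Mapping.keys t. S i \<subseteq> S j \<or> S j \<subseteq> S i)"

lemma chain_monomial_mono:
  "chain_monomial S t \<Longrightarrow> Poly_Mapping.keys s \<subseteq> Poly_Mapping.keys t \<Longrightarrow> chain_monomial S s"
  by (auto simp: chain_monomial_def)

text \<open>Divisors of chain monomials are chain monomials, so multiples of non-chain monomials are
  never chain monomials.\<close>

lemma ideal_non_chain:
  "ideal {p \<in> carrier (mpoly_ring m). \<forall>t\<in>Poly_Mapping.keys p. \<not> chain_monomial S t}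
     (mpoly_ring m :: 'k::field mpoly ring)"
  (is "ideal ?J ?R")
proof -
  interpret R: cring ?R by (rule cring_mpoly_ring)
  have mult: "p * q \<in> ?J" if "p \<in> ?J" "q \<in> carrier ?R" for p q
  proof -
    have "\<not> chain_monomial S t" if "t \<in> Poly_Mapping.keys (p * q)" for t
    proof -
      obtain a b where t: "t = a + b" "a \<in> Poly_Mapping.keys p"
        using keys_mult[of p q] \<open>t \<in> _\<close> by blast
      with \<open>p \<in> ?J\<close> have "\<not> chain_monomial S a" by simp
      moreover have "Poly_Mapping.keys a \<subseteq> Poly_Mapping.keys t" by (simp add: t keys_plus_nat)
      ultimately show ?thesis using chain_monomial_mono by blast
    qed
    with that mpoly_ring_mult_closed[of p m q] show ?thesis by blast
  qed
  show ?thesis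
  proof (rule idealI)
    show "subgroup ?J (add_monoid ?R)"
    proof (rule R.add.subgroupI)
      show "?J \<noteq> {}" by (auto intro!: exI[of _ 0])
      show "\<ominus>\<^bsub>?R\<^esub> p \<in> ?J" if "p \<in> ?J" for p
      proof -
        have "\<ominus>\<^bsub>?R\<^esub> p = - p"
          using that by (intro R.minus_equality) (simp_all add: keys_uminus_poly)
        with that show ?thesis by (simp add: keys_uminus_poly)
      qed
      show "p \<oplus>\<^bsub>?R\<^esub> q \<in> ?J" if "p \<in> ?J" "q \<in> ?J" for p q
        using that mpoly_ring_add_closed[of p m q] Poly_Mapping.keys_add[of p q]
        by (simp only: mpoly_ring_simps(3)) blast
    qed blast
    show "q \<otimes>\<^bsub>?R\<^esub> p \<in> ?J" if "p \<in> ?J" "q \<in> carrier ?R" for p q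
      using mult[OF that] by (simp only: mpoly_ring_simps(2) mult.commute[of q p])
    show "p \<otimes>\<^bsub>?R\<^esub> q \<in> ?J" if "p \<in> ?J" "q \<in> carrier ?R" for p q
      using mult[OF that] by (simp only: mpoly_ring_simps(2))
  qed (rule R.ring_axioms)
qed

text \<open>The generators are non-chain monomials; conversely, a non-chain monomial is divisible by
  some generator, and a polynomial is the sum of its terms.\<close>

lemma incomparable_ideal_eq:
  "incomparable_ideal m S =
     {p \<in> carrier (mpoly_ring m :: 'k::field mpoly ring).
        \<forall>t\<in>Poly_Mapping.keys p. \<not> chain_monomial S t}"
  (is "_ = ?J")
proof -
  let ?R = "mpoly_ring m :: 'k mpoly ring"
  interpret R: cring ?R by (rule cring_mpoly_ring)
  define G :: "'k mpoly set" where "G = {mvar i * mvar j |i j.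
       i \<in> {1..m} \<and> j \<in> {1..m} \<and> \<not> S i \<subseteq> S j \<and> \<not> S j \<subseteq> S i}"
  have mvar2: "mvar i * mvar j = (Poly_Mapping.single (Poly_Mapping.single i 1 + Poly_Mapping.single j 1) 1 :: 'k mpoly)"
    for i j by (simp add: mvar_def mult_single)
  have G_J: "G \<subseteq> ?J"
    by (auto simp: G_def mvar2 chain_monomial_def keys_plus_nat)
  then have "G \<subseteq> carrier ?R" by blast
  then have I: "ideal (Idl\<^bsub>?R\<^esub> G) ?R" by (rule R.genideal_ideal)
  interpret I: ideal "Idl\<^bsub>?R\<^esub> G" ?R by (rule I)
  have "Idl\<^bsub>?R\<^esub> G \<subseteq> ?J"
    by (rule R.genideal_minimal[OF ideal_non_chain G_J])
  moreover have "?J \<subseteq> Idl\<^bsub>?R\<^esub> G"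
  proof
    fix p assume p: "p \<in> ?J"
    have sum_mem: "(\<Sum>t\<in>A. f t) \<in> Idl\<^bsub>?R\<^esub> G"
      if "finite A" "\<And>t. t \<in> A \<Longrightarrow> f t \<in> Idl\<^bsub>?R\<^esub> G" for A :: "(nat \<Rightarrow>\<^sub>0 nat) set" and f
      using that
    proof (induction rule: finite_induct)
      case empty
      then show ?case using I.zero_closed by simp
    next
      case (insert t A)
      then show ?case using I.a_closed[of "f t" "sum f A"] by simp
    qed
    have single_mem: "Poly_Mapping.single t c \<in> Idl\<^bsub>?R\<^esub> G" if t: "t \<in> Poly_Mapping.keys p" for t c
    proof -
      from p t have "\<not> chain_monomial S t" by blast
      then obtain i j where ij: "i \<in> Poly_Mapping.keys t" "j \<in> Poly_Mapping.keys t"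
        "\<not> S i \<subseteq> S j" "\<not> S j \<subseteq> S i"
        by (auto simp: chain_monomial_def)
      have m: "Poly_Mapping.keys t \<subseteq> {1..m}" using p t by simp
      \<comment> \<open>Distinctness makes v a divisor of t: each of its two exponents is 1, so the
        truncated difference t - v is an honest quotient.\<close>
      have "i \<noteq> j" using ij by auto
      define v :: "nat \<Rightarrow>\<^sub>0 nat" where "v = Poly_Mapping.single i 1 + Poly_Mapping.single j 1"
      have t_eq: "t = v + (t - v)"
        using ij(1,2) \<open>i \<noteq> j\<close>
        by (intro poly_mapping_eqI)
          (auto simp: v_def lookup_add lookup_minus lookup_single when_def in_keys_iff)
      have "Poly_Mapping.keys (t - v) \<subseteq> Poly_Mapping.keys t"
        by (auto simp: in_keys_iff lookup_minus)
      with m have "Poly_Mapping.single (t - v) c \<in> carrier ?R" by auto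
      moreover have "mvar i * mvar j \<in> G" unfolding G_def using ij m by blast
      moreover have "G \<subseteq> Idl\<^bsub>?R\<^esub> G" using \<open>G \<subseteq> carrier ?R\<close> by (rule R.genideal_self)
      ultimately have "(mvar i * mvar j) \<otimes>\<^bsub>?R\<^esub> Poly_Mapping.single (t - v) c \<in> Idl\<^bsub>?R\<^esub> G"
        by (intro I.I_r_closed) (rule subsetD)
      moreover have "(mvar i * mvar j) * Poly_Mapping.single (t - v) c = Poly_Mapping.single t c"
        unfolding mvar2 mult_single v_def[symmetric] by (simp flip: t_eq)
      ultimately show ?thesis by (simp only: mpoly_ring_simps(2))
    qed
    have "(\<Sum>t\<in>Poly_Mapping.keys p. Poly_Mapping.single t (Poly_Mapping.lookup p t)) \<in> Idl\<^bsub>?R\<^esub> G"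
      by (rule sum_mem[OF finite_keys single_mem])
    then show "p \<in> Idl\<^bsub>?R\<^esub> G"
      by (simp only: poly_mapping_eq_sum_single[of p, symmetric])
  qed
  ultimately show ?thesis
    unfolding incomparable_ideal_def G_def[symmetric] by (rule equalityI)
qed

definition chain_monomials :: "nat \<Rightarrow> (nat \<Rightarrow> 'a set) \<Rightarrow> nat \<Rightarrow> (nat \<Rightarrow>\<^sub>0 nat) set" where
  "chain_monomials m S k =
     {t. Poly_Mapping.keys t \<subseteq> {1..m} \<and> monom_degree t = k \<and> chain_monomial S t}"

text \<open>Modulo the ideal, non-chain monomials vanish, while no nonzero combination of chain
  monomials does; hence the latter give a basis.\<close>

lemma dim_poset_algebra_graded:
  fixes S :: "nat \<Rightarrow> nat set"
  assumes fin: "finite (chain_monomials m S k)"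
  shows "ring.dim (poset_algebra m S :: 'k::field mpoly set ring)
           (poset_algebra_scalars m S) (poset_algebra_graded m S k) = card (chain_monomials m S k)"
proof -
  let ?R = "mpoly_ring m :: 'k mpoly ring"
  let ?I = "incomparable_ideal m S :: 'k mpoly set"
  let ?A = "poset_algebra m S :: 'k mpoly set ring"
  let ?K = "poset_algebra_scalars m S :: 'k mpoly set set"
  let ?\<pi> = "poset_algebra_proj m S :: 'k mpoly \<Rightarrow> 'k mpoly set"
  let ?F = "ring_of_type_algebra :: 'k ring"
  interpret R: cring ?R by (rule cring_mpoly_ring)
  have I: "ideal ?I ?R" unfolding incomparable_ideal_eq by (rule ideal_non_chain)
  interpret I: ideal ?I ?R by (rule I)
  have \<pi>_eq: "?\<pi> = (+>\<^bsub>?R\<^esub>) ?I" by (simp add: poset_algebra_proj_def fun_eq_iff)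
  have A_eq: "?A = ?R Quot ?I" by (simp add: poset_algebra_def)
  interpret \<pi>: ring_hom_ring ?R ?A ?\<pi>
    unfolding A_eq \<pi>_eq by (rule I.rcos_ring_hom_ring)
  have \<pi>_eq_iff: "?\<pi> p = ?\<pi> q \<longleftrightarrow> (\<forall>t\<in>Poly_Mapping.keys (p - q). \<not> chain_monomial S t)"
    if "p \<in> carrier ?R" "q \<in> carrier ?R" for p q
  proof -
    have "?\<pi> p = ?\<pi> q \<longleftrightarrow> p - q \<in> ?I"
      using R.quotient_eq_iff_same_a_r_cos[OF I that] that by (simp add: \<pi>_eq)
    moreover have "p - q \<in> carrier ?R"
      using R.minus_closed[OF that] that by simp
    ultimately show ?thesis by (simp add: incomparable_ideal_eq)
  qed
  \<comment> \<open>The constant monomial has empty support and is vacuously a chain. So the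
    quotient is nontrivial, as needed for the scalars to form a subfield.\<close>
  have \<pi>_1_0: "?\<pi> 1 \<noteq> ?\<pi> 0"
    by (subst \<pi>_eq_iff) (auto simp: chain_monomial_def)

  interpret F: field ?F by (rule field_from_type_algebra)
  have "mconst \<in> ring_hom ?F ?R"
    by (rule ring_hom_memI)
      (simp_all add: ring_of_type_algebra_def mconst_def mult_single single_add split: if_splits)
  then have "?\<pi> \<circ> mconst \<in> ring_hom ?F ?A"
    using \<pi>.homh by (rule ring_hom_trans)
  then interpret c: ring_hom_ring ?F ?A "?\<pi> \<circ> mconst"
    by (intro ring_hom_ringI2 F.ring_axioms \<pi>.S.ring_axioms)
  have "\<one>\<^bsub>?A\<^esub> \<noteq> \<zero>\<^bsub>?A\<^esub>"
    using \<pi>_1_0 \<pi>.hom_one \<pi>.hom_zero by simp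
  from c.img_is_subfield(2)[OF F.carrier_is_subfield this]
  have K: "subfield ?K ?A"
    by (simp add: poset_algebra_scalars_def ring_of_type_algebra_def image_comp comp_def)

  have single_carrier: "Poly_Mapping.single t c \<in> carrier ?R"
    if "t \<in> chain_monomials m S k" for t c
    using that by (simp add: chain_monomials_def)
  have carrier_sub: "p \<in> carrier ?R"
    if "Poly_Mapping.keys p \<subseteq> T" "T \<subseteq> chain_monomials m S k" for p T
    using that by (auto simp: chain_monomials_def)
  \<comment> \<open>The predicate \<open>dimension\<close> grows by one line extension at a time, so
    the monomials are adjoined singly. Independence means that each new class lies outside the span
    reached so far.\<close>
  have dim: "\<pi>.S.dimension (card T) ?K (?\<pi> ` {p. Poly_Mapping.keys p \<subseteq> T})"
    if "T \<subseteq> chain_monomials m S k" for T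
    using finite_subset[OF that fin] that
  proof (induction rule: finite_induct)
    case empty
    have "?\<pi> ` {p. Poly_Mapping.keys p \<subseteq> {}} = {\<zero>\<^bsub>?A\<^esub>}"
      using \<pi>.hom_zero by auto
    then show ?case by (simp add: \<pi>.S.dimension.intros(1))
  next
    case (insert t T)
    let ?E = "?\<pi> ` {p. Poly_Mapping.keys p \<subseteq> T}"
    let ?x = "Poly_Mapping.single t 1 :: 'k mpoly"
    have x: "?x \<in> carrier ?R" using insert.prems single_carrier by blast
    have T: "T \<subseteq> chain_monomials m S k" using insert.prems by blast
    have "?\<pi> ?x \<notin> ?E"
    proof
      assume "?\<pi> ?x \<in> ?E"
      then obtain q where q: "Poly_Mapping.keys q \<subseteq> T" "?\<pi> ?x = ?\<pi> q" by auto
      have "t \<notin> Poly_Mapping.keys q" using q(1) insert.hyps by blast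
      then have "t \<in> Poly_Mapping.keys (?x - q)"
        by (simp add: in_keys_iff lookup_minus)
      moreover have "chain_monomial S t" using insert.prems by (simp add: chain_monomials_def)
      ultimately show False
        using \<pi>_eq_iff[OF x carrier_sub[OF q(1) T]] q(2) by blast
    qed
    have decomp: "?\<pi> (mconst c * ?x + q) = ?\<pi> (mconst c) \<otimes>\<^bsub>?A\<^esub> ?\<pi> ?x \<oplus>\<^bsub>?A\<^esub> ?\<pi> q"
      if "Poly_Mapping.keys q \<subseteq> T" for c q
    proof -
      have c: "mconst c \<in> carrier ?R" by (simp add: mconst_def)
      then have "mconst c * ?x \<in> carrier ?R" using x by (rule mpoly_ring_mult_closed)
      from \<pi>.hom_add[OF this carrier_sub[OF that T]] \<pi>.hom_mult[OF c x]
      show ?thesis by (simp only: mpoly_ring_simps(2,3))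
    qed
    have "?\<pi> ` {p. Poly_Mapping.keys p \<subseteq> insert t T} = \<pi>.S.line_extension ?K (?\<pi> ?x) ?E"
    proof (intro equalityI subsetI)
      fix y assume "y \<in> ?\<pi> ` {p. Poly_Mapping.keys p \<subseteq> insert t T}"
      then obtain p where p: "Poly_Mapping.keys p \<subseteq> insert t T" "y = ?\<pi> p" by auto
      define c where "c = Poly_Mapping.lookup p t"
      define q where "q = p - Poly_Mapping.single t c"
      have q: "Poly_Mapping.keys q \<subseteq> T"
        using p(1) by (auto simp: q_def c_def in_keys_iff lookup_minus lookup_single when_def split: if_splits)
      have "p = mconst c * ?x + q" by (simp add: mconst_def mult_single q_def)
      then have "y = ?\<pi> (mconst c) \<otimes>\<^bsub>?A\<^esub> ?\<pi> ?x \<oplus>\<^bsub>?A\<^esub> ?\<pi> q"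
        using p(2) decomp[OF q] by simp
      moreover have "?\<pi> (mconst c) \<in> ?K" by (simp add: poset_algebra_scalars_def)
      ultimately show "y \<in> \<pi>.S.line_extension ?K (?\<pi> ?x) ?E"
        unfolding \<pi>.S.line_extension_mem_iff using q by blast
    next
      fix y assume "y \<in> \<pi>.S.line_extension ?K (?\<pi> ?x) ?E"
      then obtain c q where q: "Poly_Mapping.keys q \<subseteq> T"
        and y: "y = ?\<pi> (mconst c) \<otimes>\<^bsub>?A\<^esub> ?\<pi> ?x \<oplus>\<^bsub>?A\<^esub> ?\<pi> q"
        unfolding \<pi>.S.line_extension_mem_iff poset_algebra_scalars_def by blast
      then have "y = ?\<pi> (mconst c * ?x + q)" by (simp only: decomp)
      moreover have "Poly_Mapping.keys (mconst c * ?x + q) \<subseteq> insert t T"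
        using q Poly_Mapping.keys_add[of "Poly_Mapping.single t c" q]
        by (auto simp: mconst_def mult_single split: if_splits)
      ultimately show "y \<in> ?\<pi> ` {p. Poly_Mapping.keys p \<subseteq> insert t T}" by blast
    qed
    with \<pi>.S.dimension.intros(2)[OF \<pi>.hom_closed[OF x] \<open>?\<pi> ?x \<notin> ?E\<close> insert.IH[OF T]] insert.hyps
    show ?case by (simp only: card_insert_disjoint not_False_eq_True)
  qed
  have "?\<pi> ` {p. Poly_Mapping.keys p \<subseteq> chain_monomials m S k} = poset_algebra_graded m S k"
  proof (intro equalityI subsetI)
    fix y assume "y \<in> ?\<pi> ` {p. Poly_Mapping.keys p \<subseteq> chain_monomials m S k}"
    moreover have "{p :: 'k mpoly. Poly_Mapping.keys p \<subseteq> chain_monomials m S k} \<subseteq> homogeneous_polys m k"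
      by (auto simp: homogeneous_polys_def chain_monomials_def)
    ultimately show "y \<in> poset_algebra_graded m S k"
      unfolding poset_algebra_graded_def by blast
  next
    fix y :: "'k mpoly set" assume "y \<in> poset_algebra_graded m S k"
    then obtain p where p: "p \<in> homogeneous_polys m k" "y = ?\<pi> p"
      by (auto simp: poset_algebra_graded_def)
    \<comment> \<open>Dropping the non-chain terms of p changes it only by an element of the
      ideal.\<close>
    define q where "q = (\<Sum>t\<in>Poly_Mapping.keys p \<inter> {t. chain_monomial S t}.
                            Poly_Mapping.single t (Poly_Mapping.lookup p t))"
    have lookup_q: "Poly_Mapping.lookup q t = (if chain_monomial S t then Poly_Mapping.lookup p t else 0)" for t
    proof -
      have "Poly_Mapping.lookup q t =
          (\<Sum>s\<in>Poly_Mapping.keys p \<inter> {t. chain_monomial S t}. if s = t then Poly_Mapping.lookup p s else 0)"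
        by (simp add: q_def lookup_sum lookup_single when_def)
      also have "\<dots> = (if chain_monomial S t then Poly_Mapping.lookup p t else 0)"
        by (subst sum.delta) (auto simp: in_keys_iff)
      finally show ?thesis .
    qed
    have q: "Poly_Mapping.keys q \<subseteq> chain_monomials m S k"
      using p(1) by (auto simp: in_keys_iff lookup_q chain_monomials_def homogeneous_polys_def split: if_splits)
    have "\<forall>t\<in>Poly_Mapping.keys (p - q). \<not> chain_monomial S t"
      by (auto simp: in_keys_iff lookup_minus lookup_q)
    moreover have "p \<in> carrier ?R" using p(1) by (simp add: homogeneous_polys_def)
    ultimately have "y = ?\<pi> q"
      using \<pi>_eq_iff[OF _ carrier_sub[OF q subset_refl], of p] p(2) by blast
    with q show "y \<in> ?\<pi> ` {p. Poly_Mapping.keys p \<subseteq> chain_monomials m S k}" by blast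
  qed
  with dim[OF subset_refl]
  have "\<pi>.S.dimension (card (chain_monomials m S k)) ?K (poset_algebra_graded m S k)"
    by (simp only:)
  from \<pi>.S.dimI[OF K this] show ?thesis by (simp only: over_def)
qed

section \<open>Counting monomials supported on chains\<close>

lemma monom_degree_eq_sum:
  assumes "Poly_Mapping.keys t \<subseteq> {1..m}"
  shows "monom_degree t = (\<Sum>i\<in>{1..m}. Poly_Mapping.lookup t i)"
  unfolding monom_degree_def
  by (rule sum.mono_neutral_left) (use assms in \<open>auto simp: in_keys_iff\<close>)

text \<open>Adding exponents multiplies variables: this is the product of the x_(h j). A word allows
  the factors to be listed in the order of the chain.\<close>

definition monomial_of_word :: "(nat \<Rightarrow> nat) \<Rightarrow> nat \<Rightarrow> (nat \<Rightarrow>\<^sub>0 nat)" where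
  "monomial_of_word h k = (\<Sum>j<k. Poly_Mapping.single (h j) 1)"

lemma lookup_monomial_of_word:
  "Poly_Mapping.lookup (monomial_of_word h k) i = card {j \<in> {..<k}. h j = i}"
  unfolding card_filter_eq_sum[OF finite_lessThan]
  by (simp add: monomial_of_word_def lookup_sum lookup_single when_def del: One_nat_def)

lemma keys_monomial_of_word: "Poly_Mapping.keys (monomial_of_word h k) = h ` {..<k}"
  by (auto simp: in_keys_iff lookup_monomial_of_word)

text \<open>The weight 1 gives the degree; an indicator counts the factors whose set misses a given
  point.\<close>

lemma sum_monomial_of_word:
  fixes g :: "nat \<Rightarrow> nat"
  assumes "finite M" "h ` {..<k} \<subseteq> M"
  shows "(\<Sum>i\<in>M. g i * Poly_Mapping.lookup (monomial_of_word h k) i) = (\<Sum>j<k. g (h j))"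
proof -
  have "(\<Sum>i\<in>M. g i * Poly_Mapping.lookup (monomial_of_word h k) i) =
      (\<Sum>i\<in>M. \<Sum>j<k. if h j = i then g i else 0)"
    by (simp add: monomial_of_word_def lookup_sum lookup_single when_def sum_distrib_left if_distrib cong: if_cong)
  also have "\<dots> = (\<Sum>j<k. \<Sum>i\<in>M. if h j = i then g i else 0)" by (rule sum.swap)
  also have "\<dots> = (\<Sum>j<k. g (h j))"
    using assms by (intro sum.cong refl) (auto simp: sum.delta')
  finally show ?thesis .
qed

text \<open>
  A multichain \<open>S\<^sub>0 \<subseteq> \<dots> \<subseteq> S\<^bsub>k-1\<^esub>\<close> amounts to its union \<open>A\<close> and the map
  sending \<open>a \<in> A\<close> to the first index at which it appears; read off from a monomial, this index
  is the number of factors (with multiplicity) whose set misses \<open>a\<close>.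
\<close>

lemma bij_betw_chain_monomials:
  fixes S :: "nat \<Rightarrow> 'a set"
  assumes bij: "bij_betw S {1..m} P"
    and down: "\<forall>A\<in>P. Pow A \<subseteq> P" and empty: "{} \<in> P"
  shows "bij_betw (\<lambda>(A, f). monomial_of_word (\<lambda>j. inv_into {1..m} S {a \<in> A. f a \<le> j}) k)
           (SIGMA A:P. A \<rightarrow>\<^sub>E {..<k}) (chain_monomials m S k)"
proof -
  define idx where "idx = inv_into {1..m} S"
  have idx: "idx B \<in> {1..m}" "S (idx B) = B" if "B \<in> P" for B
    using that bij unfolding idx_def
    by (metis bij_betw_imp_surj_on inv_into_into, metis bij_betw_inv_into_right)
  have idx_S: "idx (S i) = i" "S i \<in> P" if "i \<in> {1..m}" for i
    using that bij unfolding idx_def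
    by (metis bij_betw_inv_into_left, metis bij_betwE)
  \<comment> \<open>For fixed A and f this is the j-th member of the multichain: increasing in j,
    and in P by downward closure.\<close>
  define level where "level A f j = {a \<in> A. f a \<le> j}" for A :: "'a set" and f :: "'a \<Rightarrow> nat" and j
  define \<Phi> where "\<Phi> = (\<lambda>(A, f). monomial_of_word (\<lambda>j. idx (level A f j)) k)"
  define W where "W t a = (\<Sum>i\<in>{1..m}. if a \<notin> S i then Poly_Mapping.lookup t i else 0)"
    for t :: "nat \<Rightarrow>\<^sub>0 nat" and a
  define U where "U t = (\<Union>i\<in>Poly_Mapping.keys t. S i)" for t :: "nat \<Rightarrow>\<^sub>0 nat"
  define \<Psi> where "\<Psi> t = (U t, restrict (W t) (U t))" for t
  have level: "level A f j \<in> P" if "A \<in> P" for A f j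
    using that down by (auto simp: level_def)
  have \<Phi>_sum: "(\<Sum>i\<in>{1..m}. g i * Poly_Mapping.lookup (\<Phi> (A, f)) i) = (\<Sum>j<k. g (idx (level A f j)))"
    if "A \<in> P" for A f and g :: "nat \<Rightarrow> nat"
    unfolding \<Phi>_def prod.case by (rule sum_monomial_of_word) (use idx(1)[OF level[OF that]] in auto)
  have keys_\<Phi>: "Poly_Mapping.keys (\<Phi> (A, f)) = (\<lambda>j. idx (level A f j)) ` {..<k}" for A f
    by (simp add: \<Phi>_def keys_monomial_of_word)

  have "bij_betw \<Phi> (SIGMA A:P. A \<rightarrow>\<^sub>E {..<k}) (chain_monomials m S k)"
  proof (rule bij_betw_byWitness[where f' = \<Psi>])
    show "\<Phi> ` (SIGMA A:P. A \<rightarrow>\<^sub>E {..<k}) \<subseteq> chain_monomials m S k"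
    proof (clarify)
      fix A f assume A: "A \<in> P"
      have keys: "Poly_Mapping.keys (\<Phi> (A, f)) \<subseteq> {1..m}"
        using idx(1)[OF level[OF A]] by (auto simp: keys_\<Phi>)
      have "monom_degree (\<Phi> (A, f)) = k"
        using \<Phi>_sum[OF A, of "\<lambda>_. 1" f] monom_degree_eq_sum[OF keys] by simp
      moreover have "level A f i \<subseteq> level A f j \<or> level A f j \<subseteq> level A f i" for i j
        by (cases "i \<le> j") (auto simp: level_def)
      then have "chain_monomial S (\<Phi> (A, f))"
        by (simp add: chain_monomial_def keys_\<Phi> idx(2)[OF level[OF A]])
      ultimately show "\<Phi> (A, f) \<in> chain_monomials m S k"
        using keys by (simp add: chain_monomials_def)
    qed
    show "\<forall>x\<in>SIGMA A:P. A \<rightarrow>\<^sub>E {..<k}. \<Psi> (\<Phi> x) = x"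
    proof (clarify)
      fix A f assume A: "A \<in> P" and f: "f \<in> A \<rightarrow>\<^sub>E {..<k}"
      have U: "U (\<Phi> (A, f)) = A"
      proof -
        have "U (\<Phi> (A, f)) = (\<Union>j<k. level A f j)"
          by (simp add: U_def keys_\<Phi> idx(2)[OF level[OF A]])
        also have "\<dots> = A"
          using f by (auto simp: level_def)
        finally show ?thesis .
      qed
      have "W (\<Phi> (A, f)) a = f a" if a: "a \<in> A" for a
      proof -
        have "W (\<Phi> (A, f)) a =
            (\<Sum>i\<in>{1..m}. (if a \<notin> S i then 1 else 0) * Poly_Mapping.lookup (\<Phi> (A, f)) i)"
          unfolding W_def by (intro sum.cong) auto
        also have "\<dots> = (\<Sum>j<k. if a \<notin> level A f j then 1 else 0)"
          by (simp only: \<Phi>_sum[OF A] idx(2)[OF level[OF A]])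
        also have "\<dots> = card {j \<in> {..<k}. a \<notin> level A f j}"
          by (rule card_filter_eq_sum[OF finite_lessThan, symmetric])
        \<comment> \<open>The point a enters at index f a < k and stays, so exactly the first f a
          levels miss it.\<close>
        also have "{j \<in> {..<k}. a \<notin> level A f j} = {..<f a}"
        proof -
          have "f a < k" using f a by auto
          then show ?thesis using a by (auto simp: level_def)
        qed
        finally show ?thesis by simp
      qed
      then have "restrict (W (\<Phi> (A, f))) A = f"
        using f by (intro ext) (auto simp: restrict_def PiE_def extensional_def)
      then show "\<Psi> (\<Phi> (A, f)) = (A, f)" by (simp add: \<Psi>_def U)
    qed
    show "\<Psi> ` chain_monomials m S k \<subseteq> (SIGMA A:P. A \<rightarrow>\<^sub>E {..<k})"
    proof (rule image_subsetI)
      fix t assume "t \<in> chain_monomials m S k"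
      then have keys: "Poly_Mapping.keys t \<subseteq> {1..m}" and deg: "(\<Sum>i\<in>{1..m}. Poly_Mapping.lookup t i) = k"
        and chain: "chain_monomial S t"
        by (auto simp: chain_monomials_def monom_degree_eq_sum)
      \<comment> \<open>On a chain the union is the largest set occurring; for the constant monomial
        it is empty, which is where \<open>{} \<in> P\<close> enters.\<close>
      have "U t \<in> P"
      proof (cases "Poly_Mapping.keys t = {}")
        case True
        with empty show ?thesis by (simp add: U_def)
      next
        case False
        then obtain M where M: "M \<in> S ` Poly_Mapping.keys t"
          "\<And>B. B \<in> S ` Poly_Mapping.keys t \<Longrightarrow> M \<subseteq> B \<Longrightarrow> M = B"
          using finite_has_maximal[of "S ` Poly_Mapping.keys t"] by auto
        have "S i \<subseteq> M" if "i \<in> Poly_Mapping.keys t" for i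
          using M that chain unfolding chain_monomial_def by blast
        then have "U t = M" using M(1) by (auto simp: U_def)
        then show ?thesis using M(1) keys idx_S(2) by auto
      qed
      moreover have "W t a < k" if "a \<in> U t" for a
      proof -
        obtain i where i: "i \<in> Poly_Mapping.keys t" "a \<in> S i" using \<open>a \<in> U t\<close> by (auto simp: U_def)
        \<comment> \<open>Strict because some factor's set contains a and that factor is not
          counted.\<close>
        have "W t a < (\<Sum>i\<in>{1..m}. Poly_Mapping.lookup t i)"
          unfolding W_def
        proof (rule sum_strict_mono_ex1)
          have "i \<in> {1..m}" using i(1) keys by blast
          moreover have "Poly_Mapping.lookup t i > 0" using i(1) by (simp add: in_keys_iff)
          ultimately show "\<exists>i\<in>{1..m}. (if a \<notin> S i then Poly_Mapping.lookup t i else 0) < Poly_Mapping.lookup t i"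
            using i(2) by (intro bexI[of _ i]) auto
        qed auto
        with deg show ?thesis by simp
      qed
      ultimately show "\<Psi> t \<in> (SIGMA A:P. A \<rightarrow>\<^sub>E {..<k})" by (auto simp: \<Psi>_def)
    qed
    show "\<forall>t\<in>chain_monomials m S k. \<Phi> (\<Psi> t) = t"
    proof
      fix t assume t: "t \<in> chain_monomials m S k"
      then have keys: "Poly_Mapping.keys t \<subseteq> {1..m}" and deg: "(\<Sum>i\<in>{1..m}. Poly_Mapping.lookup t i) = k"
        and chain: "chain_monomial S t"
        by (auto simp: chain_monomials_def monom_degree_eq_sum)
      let ?l = "Poly_Mapping.lookup t"
      define L where "L j = level (U t) (restrict (W t) (U t)) j" for j
      have U_P: "U t \<in> P"
        using \<open>\<Psi> ` chain_monomials m S k \<subseteq> _\<close> t by (auto simp: \<Psi>_def)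
      have lookup_\<Phi>: "Poly_Mapping.lookup (\<Phi> (\<Psi> t)) i = card {j \<in> {..<k}. idx (L j) = i}" for i
        by (simp add: \<Phi>_def \<Psi>_def lookup_monomial_of_word L_def)
      \<comment> \<open>One inequality per exponent is enough, since both monomials have degree
        k.\<close>
      have le: "?l i \<le> Poly_Mapping.lookup (\<Phi> (\<Psi> t)) i" if i: "i \<in> {1..m}" for i
      proof (cases "i \<in> Poly_Mapping.keys t")
        case False
        then show ?thesis by (simp add: in_keys_iff)
      next
        case True
        \<comment> \<open>With the factors of t sorted by inclusion, s of them precede the copies of
          i, which then occupy the places s, ..., s + ?l i - 1.\<close>
        define s where "s = (\<Sum>i'\<in>{1..m}. if S i' \<subset> S i then ?l i' else 0)"
        have s_eq: "s + ?l i = (\<Sum>i'\<in>{1..m}. (if S i' \<subset> S i then ?l i' else 0) + (if i' = i then ?l i' else 0))"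
          using i by (simp add: s_def sum.distrib)
        have comparable: "S i' \<subseteq> S i \<or> S i \<subseteq> S i'" if "?l i' \<noteq> 0" for i'
          using that True chain by (auto simp: chain_monomial_def in_keys_iff)
        have "s + ?l i \<le> k"
          unfolding s_eq deg[symmetric] by (rule sum_mono) auto
        moreover have "idx (L j) = i" if j: "j \<in> {s..<s + ?l i}" for j
        proof -
          \<comment> \<open>Points of S i are missed only by factors strictly below S i; points
            outside are missed by these and by all copies of i. This pins the level at such j to S
            i.\<close>
          have W_le: "W t a \<le> s" if "a \<in> S i" for a
            unfolding W_def s_def
          proof (rule sum_mono)
            fix i'
            have "S i' \<subset> S i" if "a \<notin> S i'" "?l i' \<noteq> 0"
              using that \<open>a \<in> S i\<close> comparable[of i'] by blast
            then show "(if a \<notin> S i' then ?l i' else 0) \<le> (if S i' \<subset> S i then ?l i' else 0)"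
              by (cases "?l i' = 0") auto
          qed
          have W_ge: "s + ?l i \<le> W t a" if "a \<notin> S i" for a
            unfolding W_def s_eq
            by (rule sum_mono) (use that in auto)
          have "a \<in> L j \<longleftrightarrow> a \<in> S i" for a
          proof (cases "a \<in> S i")
            case True
            with \<open>i \<in> Poly_Mapping.keys t\<close> W_le[OF True] j show ?thesis
              by (auto simp: L_def level_def U_def)
          next
            case False
            with W_ge[OF False] j show ?thesis by (auto simp: L_def level_def)
          qed
          then have "L j = S i" by blast
          then show ?thesis using idx_S i by simp
        qed
        ultimately have "{s..<s + ?l i} \<subseteq> {j \<in> {..<k}. idx (L j) = i}" by auto
        from card_mono[OF _ this] show ?thesis by (simp add: lookup_\<Phi>)
      qed
      have "(\<Sum>i\<in>{1..m}. Poly_Mapping.lookup (\<Phi> (\<Psi> t)) i) = k"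
        using \<Phi>_sum[OF U_P, of "\<lambda>_. 1" "restrict (W t) (U t)"] by (simp add: \<Psi>_def)
      with deg have total: "sum ?l {1..m} = sum (Poly_Mapping.lookup (\<Phi> (\<Psi> t))) {1..m}" by simp
      have inside: "Poly_Mapping.lookup (\<Phi> (\<Psi> t)) i = ?l i" if "i \<in> {1..m}" for i
        by (rule sum_mono_inv[where f = ?l and g = "Poly_Mapping.lookup (\<Phi> (\<Psi> t))", OF total le that, symmetric])
          simp_all
      show "\<Phi> (\<Psi> t) = t"
      proof (rule poly_mapping_eqI)
        fix i
        show "Poly_Mapping.lookup (\<Phi> (\<Psi> t)) i = ?l i"
        proof (cases "i \<in> {1..m}")
          case False
          have "idx (L j) \<in> {1..m}" for j
            unfolding L_def by (rule idx(1)[OF level[OF U_P]])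
          with False have "Poly_Mapping.lookup (\<Phi> (\<Psi> t)) i = 0"
            by (auto simp: lookup_\<Phi>)
          moreover have "?l i = 0" using False keys by (auto simp: in_keys_iff)
          ultimately show ?thesis by simp
        qed (rule inside)
      qed
    qed
  qed
  then show ?thesis by (simp only: \<Phi>_def idx_def level_def)
qed

lemma card_chain_monomials:
  fixes S :: "nat \<Rightarrow> 'a set"
  assumes bij: "bij_betw S {1..m} P" and fin: "\<forall>A\<in>P. finite A"
    and down: "\<forall>A\<in>P. Pow A \<subseteq> P" and empty: "{} \<in> P"
  shows "finite (chain_monomials m S k)"
    and "card (chain_monomials m S k) = (\<Sum>A\<in>P. k ^ card A)"
proof -
  note b = bij_betw_chain_monomials[OF bij down empty, where k = k]
  have finP: "finite P" using bij bij_betw_finite by blast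
  have finPi: "finite (A \<rightarrow>\<^sub>E {..<k})" if "A \<in> P" for A
    using fin that by (intro finite_PiE) auto
  show "finite (chain_monomials m S k)"
    using bij_betw_finite[OF b] finP finPi by blast
  have "card (chain_monomials m S k) = card (SIGMA A:P. A \<rightarrow>\<^sub>E {..<k})"
    using bij_betw_same_card[OF b] by simp
  also have "\<dots> = (\<Sum>A\<in>P. card (A \<rightarrow>\<^sub>E {..<k}))"
    using finP finPi by (intro card_SigmaI) auto
  also have "\<dots> = (\<Sum>A\<in>P. k ^ card A)"
    using fin by (intro sum.cong refl) (simp add: card_PiE)
  finally show "card (chain_monomials m S k) = (\<Sum>A\<in>P. k ^ card A)" .
qed

section \<open>Hilbert series\<close>

lemma circ_peak_hilb_eq:
  assumes "bij_betw S {1..card (circ_peak_poset n)} (circ_peak_poset n)"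
  shows "circ_peak_hilb TYPE('k::field) n S = Abs_fps (\<lambda>k. of_nat (ballot_poly n k))"
proof -
  have down: "\<forall>A\<in>circ_peak_poset n. Pow A \<subseteq> circ_peak_poset n"
    using ballot_sets_downward by (auto simp: circ_peak_poset_eq)
  have fin: "\<forall>A\<in>circ_peak_poset n. finite A"
    using ballot_setsD(2) by (simp add: circ_peak_poset_eq)
  have empty: "{} \<in> circ_peak_poset n"
    by (simp add: circ_peak_poset_eq empty_in_ballot_sets)
  note cm = card_chain_monomials[OF assms fin down empty]
  let ?m = "card (circ_peak_poset n)"
  have "ring.dim (poset_algebra ?m S :: 'k mpoly set ring)
          (poset_algebra_scalars ?m S) (poset_algebra_graded ?m S k) = ballot_poly n k" for k
    unfolding dim_poset_algebra_graded[OF cm(1)] cm(2)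
    by (simp only: ballot_poly_def circ_peak_poset_eq)
  then show ?thesis
    by (simp only: circ_peak_hilb_def Let_def hilbert_series_def)
qed

text \<open>Multiplication by 1 - x takes backward differences; taking them twice yields the
  numerators of both initial series.\<close>

lemma one_minus_X_mult_Abs_fps:
  "(1 - fps_X) * Abs_fps f = Abs_fps (\<lambda>k. f k - (if k = 0 then 0 else f (k - 1) :: 'a::comm_ring_1))"
  by (rule fps_ext) (simp add: left_diff_distrib)

lemma Abs_fps_eq_divide_one_minus_X_square:
  fixes f :: "nat \<Rightarrow> 'a::field"
  assumes "(1 - fps_X) * ((1 - fps_X) * Abs_fps f) = g"
  shows "Abs_fps f = g / (1 - fps_X) ^ 2"
proof -
  have "fps_nth (1 - fps_X :: 'a fps) 0 \<noteq> 0" by simp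
  then have "(1 - fps_X :: 'a fps) ^ 2 \<noteq> 0" by force
  then have "Abs_fps f = ((1 - fps_X) ^ 2 * Abs_fps f) / (1 - fps_X) ^ 2" by simp
  with assms show ?thesis by (simp add: power2_eq_square mult.assoc)
qed

lemma Abs_fps_Suc: "Abs_fps (\<lambda>k. of_nat (k + 1)) = (1 / (1 - fps_X) ^ 2 :: 'a::field fps)"
proof (rule Abs_fps_eq_divide_one_minus_X_square)
  have "(1 - fps_X) * Abs_fps (\<lambda>k. of_nat (k + 1)) = (Abs_fps (\<lambda>k. 1) :: 'a fps)"
    unfolding one_minus_X_mult_Abs_fps by (rule arg_cong[of _ _ Abs_fps]) auto
  moreover have "(1 - fps_X) * Abs_fps (\<lambda>k. 1) = (1 :: 'a fps)"
    unfolding one_minus_X_mult_Abs_fps by (rule fps_ext) auto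
  ultimately show "(1 - fps_X) * ((1 - fps_X) * Abs_fps (\<lambda>k. of_nat (k + 1))) = (1 :: 'a fps)"
    by simp
qed

text \<open>The differences of 1, 3, 5, ... are 1, 2, 2, ..., and theirs are 1, 1, 0, 0, ..., the
  coefficients of 1 + x.\<close>

lemma Abs_fps_odd_numbers:
  "Abs_fps (\<lambda>k. of_nat (2 * k + 1)) = ((1 + fps_X) / (1 - fps_X) ^ 2 :: 'a::field fps)"
proof (rule Abs_fps_eq_divide_one_minus_X_square)
  have "(1 - fps_X) * Abs_fps (\<lambda>k. of_nat (2 * k + 1)) = (Abs_fps (\<lambda>k. if k = 0 then 1 else 2) :: 'a fps)"
    unfolding one_minus_X_mult_Abs_fps
  proof (rule arg_cong[of _ _ Abs_fps], rule ext)
    fix k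
    show "of_nat (2 * k + 1) - (if k = 0 then 0 else of_nat (2 * (k - 1) + 1)) = (if k = 0 then 1 else 2 :: 'a)"
      by (cases k) (auto simp: algebra_simps)
  qed
  moreover have "(1 - fps_X) * Abs_fps (\<lambda>k. if k = 0 then 1 else 2) = (1 + fps_X :: 'a fps)"
    unfolding one_minus_X_mult_Abs_fps
  proof (rule fps_ext)
    fix k
    show "fps_nth (Abs_fps (\<lambda>k. (if k = 0 then 1 else 2) - (if k = 0 then 0 else if k - 1 = 0 then 1 else 2))) k
        = fps_nth (1 + fps_X :: 'a fps) k"
      by (cases k; cases "k - 1") auto
  qed
  ultimately show "(1 - fps_X) * ((1 - fps_X) * Abs_fps (\<lambda>k. of_nat (2 * k + 1))) = (1 + fps_X :: 'a fps)"
    by simp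
qed

theorem theorem4p2:
  fixes S :: "nat \<Rightarrow> nat \<Rightarrow> nat set" and H :: "nat \<Rightarrow> rat fps"
  assumes enum: "\<And>n. bij_betw (S n) {1..card (circ_peak_poset n)} (circ_peak_poset n)"
  defines "H \<equiv> \<lambda>n. circ_peak_hilb TYPE('k::field) n (S n)"
  shows "(\<forall>n\<ge>3.
            (even n \<longrightarrow> H (n + 1) = fps_X * fps_deriv (H n) + H n) \<and>
            (odd n \<longrightarrow>
               H (n + 3) = fps_X * fps_deriv (H (n + 2)) + H (n + 2)
                 + fps_const (4 * of_nat n / of_nat (n + 3)) * fps_X * fps_deriv (H (n + 1))
                 - fps_const (8 * of_nat n / of_nat (n + 3)) * fps_X * fps_deriv (H n)
                 - fps_const (4 * of_nat n / of_nat (n + 3)) * fps_X ^ 2 * fps_deriv (fps_deriv (H n))))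
         \<and> H 3 = 1 / (1 - fps_X) ^ 2
         \<and> H 4 = (1 + fps_X) / (1 - fps_X) ^ 2"
proof -
  have H: "H n = Abs_fps (\<lambda>k. of_nat (ballot_poly n k))" for n
    unfolding H_def by (rule circ_peak_hilb_eq[OF enum])
  have nth_H: "fps_nth (H n) k = of_nat (ballot_poly n k)" for n k by (simp add: H)
  have nth_XD: "fps_nth (fps_X * fps_deriv f) k = of_nat k * fps_nth f k" for f :: "rat fps" and k
    by (cases k) simp_all
  have nth_X2DD: "fps_nth (fps_X ^ 2 * fps_deriv (fps_deriv f)) k = of_nat k * (of_nat k - 1) * fps_nth f k"
    for f :: "rat fps" and k
  proof (cases k)
    case (Suc j)
    then show ?thesis
      by (cases j) (simp_all add: power2_eq_square mult.assoc algebra_simps)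
  qed (simp add: power2_eq_square mult.assoc)
  have "H (n + 1) = fps_X * fps_deriv (H n) + H n" if "n \<ge> 3" "even n" for n
  proof (rule fps_ext)
    fix k
    show "fps_nth (H (n + 1)) k = fps_nth (fps_X * fps_deriv (H n) + H n) k"
      using ballot_poly_even[of n k] that by (simp add: nth_H nth_XD algebra_simps)
  qed
  moreover have "H (n + 3) = fps_X * fps_deriv (H (n + 2)) + H (n + 2)
                 + fps_const (4 * of_nat n / of_nat (n + 3)) * fps_X * fps_deriv (H (n + 1))
                 - fps_const (8 * of_nat n / of_nat (n + 3)) * fps_X * fps_deriv (H n)
                 - fps_const (4 * of_nat n / of_nat (n + 3)) * fps_X ^ 2 * fps_deriv (fps_deriv (H n))"
    (is "_ = ?rhs") if "odd n" for n
  proof (rule fps_ext)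
    fix k
    define c :: rat where "c = 4 * of_nat n / of_nat (n + 3)"
    \<comment> \<open>The two terms in H_n combine by 2k + k (k - 1) = k (k + 1), which gives the
      factor k (k + 1) required by \<open>ballot_poly_three_term\<close>.\<close>
    have "8 * of_nat n / of_nat (n + 3) = 2 * c" by (simp add: c_def)
    then show "fps_nth (H (n + 3)) k = fps_nth ?rhs k"
      using ballot_poly_three_term[OF that, of k, where 'a = rat]
      unfolding c_def[symmetric]
      by (simp add: mult.assoc nth_H nth_XD nth_X2DD del: of_nat_add) (simp add: algebra_simps)
  qed
  moreover have "H 3 = 1 / (1 - fps_X) ^ 2"
    unfolding H ballot_poly_3 by (rule Abs_fps_Suc)
  moreover have "H 4 = (1 + fps_X) / (1 - fps_X) ^ 2"
    unfolding H ballot_poly_4 by (rule Abs_fps_odd_numbers)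
  ultimately show ?thesis by blast
qed

end
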